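(* Work in the extended real line $\overline{\mathbb{R}}=[-\infty,+\infty]$ with its usual topology. Let $I\subseteq\overline{\mathbb{R}}$ be a super-class, i.e. $I$ is exactly the collection of limit points of some arithmetically definable sequence $S=\langle q_n\rangle_{n\in\mathbb{N}}$ of rationals. Then $I$ is closed, i.e. it contains all of its limit points. In particular: (1) for all $a,b\in\overline{\mathbb{R}}$ with $a<b$, none of the open or semi-open intervals $(a,b)$, $[a,b)$, $(a,b]$ is a super-class; (2) if $\langle\rho_j\rangle_{j\in\mathbb{N}}$ is a sequence of real numbers having a limit point in $\overline{\mathbb{R}}$ that is not one of the terms $\rho_j$, then the collection $\{\rho_j : j\in\mathbb{N}\}$ is not a super-class; (3) the collection $\mathbb{Q}$ of all rational numbers (viewed as points of the real line) is not a super-class; moreover, for every arithmetically definable sequence $S$ of rationals whose terms include every rational number, the super-class represented by $S$ is the entire real line $[-\infty,+\infty]$.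
   Context: Real numbers are represented by Cauchy sequences of rationals, and $\pm\infty$ are also admitted as real numbers, represented by sequences of rationals diverging to $\pm\infty$; thus "the entire real line" means $\overline{\mathbb{R}}=[-\infty,+\infty]$. A sequence of rationals is a function $\mathbb{N}\to\mathbb{Q}$. It is arithmetically definable if it is defined by a formula in the first-order language of Peano Arithmetic (with rationals coded by pairs of integers, and integers by pairs of natural numbers); only such sequences are available. A point $x\in\overline{\mathbb{R}}$ is a limit point of a sequence $\langle s_n\rangle_{n\in\mathbb{N}}$ of rationals or reals if some subsequence of $\langle s_n\rangle$ converges to $x$ in $\overline{\mathbb{R}}$ (for example, the constant sequence $\langle 0\rangle$ has $0$ as its only limit point). A point is a limit point of a collection $I\subseteq\overline{\mathbb{R}}$ if it is a limit in $\overline{\mathbb{R}}$ of a sequence of points of $I$. A super-class of real numbers is a collection $I\subseteq\overline{\mathbb{R}}$ for which there is an arithmetically definable sequence $S$ of rationals whose collection of limit points is precisely $I$; then $S$ is said to represent $I$. *)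

theory Defs
  imports "HOL-Analysis.Analysis"
begin

text \<open>Syntax and standard semantics of the first-order language of Peano Arithmetic,
  with variables named by natural numbers.\<close>

datatype pa_term =
    Var nat
  | Zero
  | Succ pa_term
  | Plus pa_term pa_term
  | Times pa_term pa_term

datatype pa_form =
    Eq pa_term pa_term
  | Neg pa_form
  | And pa_form pa_form
  | Or pa_form pa_form
  | Imp pa_form pa_form
  | Forall nat pa_form
  | Exists nat pa_form

primrec term_vars :: "pa_term \<Rightarrow> nat set" where
  "term_vars (Var x) = {x}"
| "term_vars Zero = {}"
| "term_vars (Succ t) = term_vars t"
| "term_vars (Plus s t) = term_vars s \<union> term_vars t"
| "term_vars (Times s t) = term_vars s \<union> term_vars t"

primrec free_vars :: "pa_form \<Rightarrow> nat set" where
  "free_vars (Eq s t) = term_vars s \<union> term_vars t"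
| "free_vars (Neg p) = free_vars p"
| "free_vars (And p q) = free_vars p \<union> free_vars q"
| "free_vars (Or p q) = free_vars p \<union> free_vars q"
| "free_vars (Imp p q) = free_vars p \<union> free_vars q"
| "free_vars (Forall x p) = free_vars p - {x}"
| "free_vars (Exists x p) = free_vars p - {x}"

primrec term_val :: "(nat \<Rightarrow> nat) \<Rightarrow> pa_term \<Rightarrow> nat" where
  "term_val e (Var x) = e x"
| "term_val e Zero = 0"
| "term_val e (Succ t) = Suc (term_val e t)"
| "term_val e (Plus s t) = term_val e s + term_val e t"
| "term_val e (Times s t) = term_val e s * term_val e t"

primrec holds :: "(nat \<Rightarrow> nat) \<Rightarrow> pa_form \<Rightarrow> bool" where
  "holds e (Eq s t) \<longleftrightarrow> term_val e s = term_val e t"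
| "holds e (Neg p) \<longleftrightarrow> \<not> holds e p"
| "holds e (And p q) \<longleftrightarrow> holds e p \<and> holds e q"
| "holds e (Or p q) \<longleftrightarrow> holds e p \<or> holds e q"
| "holds e (Imp p q) \<longleftrightarrow> (holds e p \<longrightarrow> holds e q)"
| "holds e (Forall x p) \<longleftrightarrow> (\<forall>k. holds (e(x := k)) p)"
| "holds e (Exists x p) \<longleftrightarrow> (\<exists>k. holds (e(x := k)) p)"

text \<open>An integer is coded by a pair of naturals (their difference), and a rational by a pair of
  integers (numerator and nonzero denominator), hence by four naturals.\<close>

definition codes_int :: "nat \<Rightarrow> nat \<Rightarrow> int \<Rightarrow> bool" where
  "codes_int a b z \<longleftrightarrow> z = int a - int b"

definition codes_rat :: "nat \<Rightarrow> nat \<Rightarrow> nat \<Rightarrow> nat \<Rightarrow> rat \<Rightarrow> bool" where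
  "codes_rat a b c d r \<longleftrightarrow>
    (\<exists>u v. codes_int a b u \<and> codes_int c d v \<and> v \<noteq> 0 \<and> r = Fract u v)"

text \<open>The formula defines the graph of the sequence: variable 0 holds the index, variables 1 to 4
  hold a code of the value. There are no further free variables, hence no parameters.\<close>

definition arith_definable :: "(nat \<Rightarrow> rat) \<Rightarrow> bool" where
  "arith_definable S \<longleftrightarrow>
    (\<exists>\<phi>. free_vars \<phi> \<subseteq> {0, 1, 2, 3, 4} \<and>
      (\<forall>e. holds e \<phi> \<longleftrightarrow> codes_rat (e 1) (e 2) (e 3) (e 4) (S (e 0))))"

definition ereal_of_rat :: "rat \<Rightarrow> ereal" where
  "ereal_of_rat r = ereal (real_of_rat r)"

definition seq_limit_points :: "(nat \<Rightarrow> ereal) \<Rightarrow> ereal set" where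
  "seq_limit_points s = {x. \<exists>r. strict_mono r \<and> (s \<circ> r) \<longlonglongrightarrow> x}"

text \<open>The approximating points need not differ from \<open>x\<close>, unlike for the library's
  \<^const>\<open>islimpt\<close>.\<close>

definition collection_limit_points :: "ereal set \<Rightarrow> ereal set" where
  "collection_limit_points I = {x. \<exists>s. (\<forall>n. s n \<in> I) \<and> s \<longlonglongrightarrow> x}"

definition represents :: "(nat \<Rightarrow> rat) \<Rightarrow> ereal set \<Rightarrow> bool" where
  "represents S I \<longleftrightarrow> arith_definable S \<and> seq_limit_points (ereal_of_rat \<circ> S) = I"

definition super_class :: "ereal set \<Rightarrow> bool" where
  "super_class I \<longleftrightarrow> (\<exists>S. represents S I)"

end

theory Submission
  imports Defs
begin

text \<open>Since the extended real line is first countable, \<open>x\<close> is a limit point of a sequence iff every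
  neighbourhood of \<open>x\<close> contains infinitely many terms (counted by index). If \<open>x\<close> fails this for an
  open \<open>U\<close>, then so does every point of \<open>U\<close>, so the set of limit points is closed. Definability of
  the sequence plays no role.\<close>

lemma seq_limit_points_iff:
  "x \<in> seq_limit_points s \<longleftrightarrow> (\<forall>U. open U \<and> x \<in> U \<longrightarrow> infinite {n. s n \<in> U})"
proof
  assume "x \<in> seq_limit_points s"
  then obtain r where r: "strict_mono r" and lim: "(s \<circ> r) \<longlonglongrightarrow> x"
    by (auto simp: seq_limit_points_def)
  show "\<forall>U. open U \<and> x \<in> U \<longrightarrow> infinite {n. s n \<in> U}"
  proof (intro allI impI)
    fix U :: "ereal set" assume "open U \<and> x \<in> U"
    then obtain N where N: "s (r n) \<in> U" if "n \<ge> N" for n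
      using lim by (auto simp: tendsto_def eventually_sequentially)
    \<comment> \<open>Infinitude is a matter of indices, not of values: \<open>r\<close> is
      injective, so its tail supplies infinitely many indices even when the terms of
      \<open>s\<close> repeat.\<close>
    have "infinite (r ` {N..})"
      using strict_mono_imp_inj_on[OF r] infinite_Ici finite_imageD inj_on_subset by blast
    moreover have "r ` {N..} \<subseteq> {n. s n \<in> U}"
      using N by auto
    ultimately show "infinite {n. s n \<in> U}"
      using finite_subset by blast
  qed
next
  assume inf: "\<forall>U. open U \<and> x \<in> U \<longrightarrow> infinite {n. s n \<in> U}"
  obtain A :: "nat \<Rightarrow> ereal set" where A: "\<And>i. open (A i)" "\<And>i. x \<in> A i"
    "\<And>U. open U \<Longrightarrow> x \<in> U \<Longrightarrow> eventually (\<lambda>i. A i \<subseteq> U) sequentially"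
    by (rule countable_basis_at_decseq[of x]) blast
  \<comment> \<open>An infinite set of indices is unbounded. So the \<open>n\<close>-th index of the
    subsequence can be chosen beyond its predecessor with its term in \<open>A n\<close>, and the
    sets \<open>A n\<close> eventually lie inside any given neighbourhood of
    \<open>x\<close>.\<close>
  have "\<exists>n>m. s n \<in> A i" for m i
    using inf A by (fastforce simp: infinite_nat_iff_unbounded)
  then have "\<exists>r. \<forall>n. s (r n) \<in> A n \<and> r n < r (Suc n)"
    by (intro dependent_nat_choice) auto
  then obtain r where r: "\<And>n. s (r n) \<in> A n" "\<And>n. r n < r (Suc n)"
    by blast
  have "(s \<circ> r) \<longlonglongrightarrow> x"
  proof (rule topological_tendstoI)
    fix U assume "open U" "x \<in> U"
    from A(3)[OF this] show "eventually (\<lambda>n. (s \<circ> r) n \<in> U) sequentially"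
      by (rule eventually_mono) (use r in auto)
  qed
  then show "x \<in> seq_limit_points s"
    using r by (auto simp: seq_limit_points_def strict_mono_Suc_iff)
qed

lemma closed_seq_limit_points: "closed (seq_limit_points s)"
  unfolding closed_def
proof (subst open_subopen, intro ballI)
  fix x assume "x \<in> - seq_limit_points s"
  then obtain U where "open U" "x \<in> U" "finite {n. s n \<in> U}"
    by (auto simp: seq_limit_points_iff)
  then show "\<exists>T. open T \<and> x \<in> T \<and> T \<subseteq> - seq_limit_points s"
    by (intro exI[of _ U]) (auto simp: seq_limit_points_iff)
qed

lemma closed_super_class: "super_class I \<Longrightarrow> closed I"
  unfolding super_class_def represents_def using closed_seq_limit_points by metis

text \<open>All three intervals have closure \<open>{a..b}\<close>, and each omits an
  endpoint.\<close>

lemma not_closed_ereal_intervals: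
  fixes a b :: ereal
  assumes "a < b"
  shows "\<not> closed {a<..<b}" "\<not> closed {a..<b}" "\<not> closed {a<..b}"
proof -
  have "closure {a<..<b} = {a..b}" "closure {a..<b} = {a..b}" "closure {a<..b} = {a..b}"
    using assms by simp_all
  moreover have "a \<in> {a..b}" "b \<in> {a..b}"
    using assms by simp_all
  moreover have "a \<notin> {a<..<b}" "b \<notin> {a..<b}" "a \<notin> {a<..b}"
    by simp_all
  ultimately show "\<not> closed {a<..<b}" "\<not> closed {a..<b}" "\<not> closed {a<..b}"
    by (metis closure_closed)+
qed

lemma closed_collection_limit_points: "closed I \<Longrightarrow> collection_limit_points I \<subseteq> I"
  unfolding collection_limit_points_def using closed_sequentially by blast

text \<open>The natural numbers already escape: they tend to \<infinity>, which is not the image of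
  a rational.\<close>

lemma not_closed_range_ereal_of_rat: "\<not> closed (range ereal_of_rat)"
proof
  assume closed: "closed (range ereal_of_rat)"
  have "(\<lambda>n. ereal_of_rat (of_nat n)) \<longlonglongrightarrow> \<infinity>"
    using id_nat_ereal_tendsto_PInf by (simp add: ereal_of_rat_def)
  then have "\<infinity> \<in> range ereal_of_rat"
    by (rule closed_sequentially[OF closed, rotated]) auto
  then show False
    by (auto simp: ereal_of_rat_def)
qed

text \<open>By density the set is nonempty and has no maximum: between any of its elements and
  \<open>d\<close> lies another rational. The bounds may be infinite.\<close>

lemma infinite_rats_between:
  assumes "c < d"
  shows "infinite {q. c < ereal_of_rat q \<and> ereal_of_rat q < d}" (is "infinite ?F")
proof
  assume fin: "finite ?F"
  have dense: "\<exists>q. x < ereal_of_rat q \<and> ereal_of_rat q < y" if "x < y" for x y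
    using ereal_dense3[OF that] by (simp add: ereal_of_rat_def)
  have "?F \<noteq> {}"
    using dense[OF assms] by auto
  with fin have "Max ?F \<in> ?F"
    by (rule Max_in)
  then obtain q where q: "ereal_of_rat (Max ?F) < ereal_of_rat q" "ereal_of_rat q < d"
    using dense by blast
  with \<open>Max ?F \<in> ?F\<close> have "q \<in> ?F"
    by auto
  then have "q \<le> Max ?F"
    using fin by (rule Max_ge[rotated])
  with q show False
    by (simp add: ereal_of_rat_def of_rat_less)
qed

text \<open>The interval need not contain \<open>x\<close>, so a one-sided neighbourhood suffices:
  to the left of \<infinity>, to the right of any other point. This treats both infinite points
  together with the finite ones.\<close>

lemma open_ereal_contains_interval:
  fixes x :: ereal
  assumes "open U" "x \<in> U"
  obtains c d where "c < d" "{c<..<d} \<subseteq> U"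
proof (cases "x = \<infinity>")
  case True
  then obtain b where "b < x" "{b<..x} \<subseteq> U"
    \<comment> \<open>\<open>open_left\<close> needs some point below \<open>x\<close>; here
      -\<infinity> serves, as \<infinity> does for \<open>open_right\<close> in the other
      case.\<close>
    using open_left[OF assms, of "-\<infinity>"] by auto
  then show ?thesis
    by (intro that[of b x]) (auto simp: subset_iff)
next
  case False
  then obtain b where "x < b" "{x..<b} \<subseteq> U"
    using open_right[OF assms, of \<infinity>] by auto
  then show ?thesis
    by (intro that[of x b]) (auto simp: subset_iff)
qed

text \<open>Every nonempty open set contains infinitely many rationals, each of them a term of
  \<open>S\<close>; finitely many indices could not account for them all.\<close>

lemma seq_limit_points_surj_rat:
  assumes "range S = UNIV"
  shows "seq_limit_points (ereal_of_rat \<circ> S) = UNIV"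
proof -
  have "infinite {n. (ereal_of_rat \<circ> S) n \<in> U}" if U: "open U" "x \<in> U" for x U
  proof
    assume fin: "finite {n. (ereal_of_rat \<circ> S) n \<in> U}"
    obtain c d where cd: "c < d" "{c<..<d} \<subseteq> U"
      using open_ereal_contains_interval[OF U] .
    have "{q. c < ereal_of_rat q \<and> ereal_of_rat q < d} \<subseteq> S ` {n. (ereal_of_rat \<circ> S) n \<in> U}"
    proof
      fix q assume q: "q \<in> {q. c < ereal_of_rat q \<and> ereal_of_rat q < d}"
      obtain n where "q = S n"
        using assms by (metis UNIV_I rangeE)
      with q cd show "q \<in> S ` {n. (ereal_of_rat \<circ> S) n \<in> U}"
        by auto
    qed
    with fin infinite_rats_between[OF cd(1)] show False
      using finite_surj by blast
  qed
  then show ?thesis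
    by (auto simp: seq_limit_points_iff)
qed

text \<open>Applied with \<open>I = range \<rho>\<close>: were this range closed, it could not miss
  a limit point of \<open>\<rho>\<close>.\<close>

lemma seq_limit_points_subset_closed:
  assumes "closed I" "range s \<subseteq> I"
  shows "seq_limit_points s \<subseteq> I"
proof
  fix x assume "x \<in> seq_limit_points s"
  then obtain r where "(s \<circ> r) \<longlonglongrightarrow> x"
    by (auto simp: seq_limit_points_def)
  moreover have "\<forall>n. (s \<circ> r) n \<in> I"
    using assms(2) by auto
  ultimately show "x \<in> I"
    using closed_sequentially[OF assms(1)] by blast
qed

theorem proposition4:
  shows "(\<forall>I. super_class I \<longrightarrow> closed I \<and> collection_limit_points I \<subseteq> I) \<and>
    (\<forall>a b :: ereal. a < b \<longrightarrow>
      \<not> super_class {a<..<b} \<and> \<not> super_class {a..<b} \<and> \<not> super_class {a<..b}) \<and>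
    (\<forall>\<rho> :: nat \<Rightarrow> ereal. (\<exists>x \<in> seq_limit_points \<rho>. x \<notin> range \<rho>) \<longrightarrow>
      \<not> super_class (range \<rho>)) \<and>
    \<not> super_class (range ereal_of_rat) \<and>
    (\<forall>S. arith_definable S \<and> range S = UNIV \<longrightarrow> represents S UNIV)"
proof (intro conjI allI impI)
  show "closed I" "collection_limit_points I \<subseteq> I" if "super_class I" for I
    using that closed_super_class closed_collection_limit_points by blast+
  show "\<not> super_class {a<..<b}" "\<not> super_class {a..<b}" "\<not> super_class {a<..b}"
    if "a < b" for a b :: ereal
    using not_closed_ereal_intervals[OF that] closed_super_class by blast+
  show "\<not> super_class (range \<rho>)" if "\<exists>x \<in> seq_limit_points \<rho>. x \<notin> range \<rho>" for \<rho>
    using that seq_limit_points_subset_closed closed_super_class by blast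
  show "\<not> super_class (range ereal_of_rat)"
    using not_closed_range_ereal_of_rat closed_super_class by blast
  show "represents S UNIV" if "arith_definable S \<and> range S = UNIV" for S
    using that by (simp add: represents_def seq_limit_points_surj_rat)
qed

end
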